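(* $$\mathcal M(2^n)\subsetneqq\mathcal D_{\mathbb R}(\overline{\mathfrak g})\cap\mathscr{CS}\subsetneqq\bigcap_{1<p<2}\mathcal M(p^n).$$
   Context: Let $r=(r_n)_{n\geq0}$ be a strictly decreasing sequence of positive reals converging to $0$ with $r_{n+1}\leq\frac12r_n$ for each $n$. The symmetric Cantor set $\mathsf C(r)\subseteq\mathbb R$ is defined as follows: $I_\emptyset$ is a closed interval of length $r_0$ (its position is immaterial); if $q\in\{0,1\}^n$ and $I_q$ has been defined, then $I_{q^\frown0}$ and $I_{q^\frown1}$ are the closed subintervals of $I_q$ of length $r_{n+1}$ such that the left endpoint of $I_{q^\frown0}$ is the left endpoint of $I_q$ and the right endpoint of $I_{q^\frown1}$ is the right endpoint of $I_q$. Then $\mathsf C(r)=\bigcap_{n\geq0}\bigcup_{q\in\{0,1\}^n}I_q$. $\mathscr{CS}$ is the family of all symmetric Cantor sets $\mathsf C(r)$. For $f\colon\{0,1,2,\dots\}\to[1,\infty)$, $\mathcal M(f)$ is the family of all $\mathsf C(r)\in\mathscr{CS}$ such that for every $\varepsilon>0$ there are infinitely many $n$ with $r_n<\varepsilon^{f(n)}$. $\mathcal M(p^n)$ denotes $\mathcal M(f)$ for $f(n)=p^n$, where $p\in(1,\infty)$. $\mathfrak g=(2^{-n})_{n\geq1}$ and $\overline{\mathfrak g}=\{(2^{-kn})_{n\geq1}:k\geq1\}$. $\mathcal D_{\mathbb R}(\overline{\mathfrak g})$ is the family of all sets $E\subseteq\mathbb R$ such that for each $k\geq1$ there is a sequence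 $(E_n)_{n\geq1}$ of subsets of $\mathbb R$ that covers $E$ and satisfies $\operatorname{diam}E_n<2^{-kn}$ for all $n\geq1$ (these are exactly the microscopic subsets of $\mathbb R$). *)

theory Defs
  imports "HOL-Analysis.Analysis"
begin

definition cantor_length_seq :: "(nat \<Rightarrow> real) \<Rightarrow> bool" where
  "cantor_length_seq r \<longleftrightarrow>
     (\<forall>n. 0 < r n) \<and> (\<forall>n. r (Suc n) < r n) \<and> r \<longlonglongrightarrow> 0 \<and> (\<forall>n. r (Suc n) \<le> r n / 2)"

text \<open>
  A word \<open>q\<close> over \<open>{0,1}\<close> is a \<open>bool list\<close> with its last letter at the head, so that
  \<open>q\<close> followed by the letter \<open>b\<close> is \<open>b # q\<close> (with \<open>False\<close> for 0 and \<open>True\<close> for 1).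
  The parameter \<open>a\<close> is the left endpoint of the initial interval, i.e. its position.
\<close>

primrec cantor_left :: "real \<Rightarrow> (nat \<Rightarrow> real) \<Rightarrow> bool list \<Rightarrow> real" where
  "cantor_left a r [] = a"
| "cantor_left a r (b # q) =
     (if b then cantor_left a r q + r (length q) - r (Suc (length q)) else cantor_left a r q)"

definition cantor_interval :: "real \<Rightarrow> (nat \<Rightarrow> real) \<Rightarrow> bool list \<Rightarrow> real set" where
  "cantor_interval a r q = {cantor_left a r q .. cantor_left a r q + r (length q)}"

definition cantor_set :: "real \<Rightarrow> (nat \<Rightarrow> real) \<Rightarrow> real set" where
  "cantor_set a r = (\<Inter>n. \<Union>q\<in>{q. length q = n}. cantor_interval a r q)"

text \<open>The families below contain the symmetric Cantor sets in every position \<open>a\<close>.\<close>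

definition sym_cantor_sets :: "real set set" where
  "sym_cantor_sets = {cantor_set a r | a r. cantor_length_seq r}"

definition cantor_M :: "(nat \<Rightarrow> real) \<Rightarrow> real set set" where
  "cantor_M f = {cantor_set a r | a r.
     cantor_length_seq r \<and> (\<forall>\<epsilon>>0. infinite {n. r n < \<epsilon> powr f n})}"

text \<open>
  Sequences indexed by \<open>n \<ge> 1\<close> are functions on \<open>nat\<close> whose value at 0 is ignored.
  Boundedness is required explicitly because \<^const>\<open>diameter\<close> is unspecified
  on unbounded sets, whose diameter is infinite here.
\<close>

definition small_cover_sets :: "(nat \<Rightarrow> real) set \<Rightarrow> real set set" where
  "small_cover_sets A = {E. \<forall>s\<in>A. \<exists>C :: nat \<Rightarrow> real set.
     E \<subseteq> (\<Union>n\<in>{1..}. C n) \<and> (\<forall>n\<ge>1. bounded (C n) \<and> diameter (C n) < s n)}"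

definition geom_seqs :: "(nat \<Rightarrow> real) set" where
  "geom_seqs = {\<lambda>n. 1 / 2 ^ (k * n) | k. k \<ge> 1}"

end

theory Submission
  imports Defs "HOL-Library.Discrete_Functions" "HOL-Real_Asymp.Real_Asymp"
begin

text \<open>
  Whether a symmetric Cantor set is microscopic depends on the divergence of
  \<open>\<Sum>n. \<bar>ln (r n)\<bar> / 2 ^ n\<close>. At level \<open>n\<close> there are \<open>2 ^ n\<close> intervals, and the covering sets
  that can be as long as \<open>r n\<close> are those with index \<open>m \<le> \<bar>ln (r n)\<bar> / (k ln 2)\<close>, so the term
  \<open>\<bar>ln (r n)\<bar> / 2 ^ n\<close> measures, up to the factor \<open>k\<close>, the part of the Cantor set that can be
  covered by using intervals of level \<open>n\<close>.

  The necessity of divergence is \<open>not_microscopic_if_summable\<close>. By compactness a cover may be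
  taken finite, and a set shorter than \<open>r n\<close> meets at most two intervals of level \<open>n\<close>, hence has
  weight at most \<open>2 / 2 ^ n\<close>. The total weight must reach 1, whereas for a convergent series
  it is \<open>O(1 / k)\<close>. If \<open>r n \<ge> \<epsilon> powr p ^ n\<close> for almost all \<open>n\<close> and \<open>p < 2\<close>, the series is
  dominated by a geometric one; this gives the inclusion of the microscopic symmetric Cantor sets
  in every \<open>cantor_M (\<lambda>n. p ^ n)\<close>. The inclusion is strict because of
  \<open>ln (r n) = - (2 ^ n / (n + 3)\<^sup>2 + n)\<close>, whose modulus outgrows \<open>p ^ n\<close> for each \<open>p < 2\<close> and
  still gives a convergent series.

  For the other inclusion, a single level suffices: if \<open>r n < (1 / 2 ^ k) powr 2 ^ n\<close>, the first
  \<open>2 ^ n\<close> covering sets can be the intervals of level \<open>n\<close>. It is strict because of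
  \<open>r n = (1 / 2) ^ 2 ^ n\<close>: each level contributes the same positive fraction to a cover,
  so finitely many consecutive levels together form one. No other sequence of lengths can
  represent it as a member of \<open>cantor_M (\<lambda>n. 2 ^ n)\<close> either, because nested symmetric Cantor sets
  have comparable lengths (\<open>length_le_of_cantor_set_subset\<close>).
\<close>

section \<open>Geometry of the intervals and their endpoints\<close>

lemma length_seq_pos: "cantor_length_seq r \<Longrightarrow> 0 < r n"
  by (simp add: cantor_length_seq_def)

lemma length_seq_half: "cantor_length_seq r \<Longrightarrow> r (Suc n) \<le> r n / 2"
  by (simp add: cantor_length_seq_def)

lemma cantor_left_mono:
  assumes "cantor_length_seq r"
  shows "cantor_left a r q \<le> cantor_left a r (w @ q)"
proof (induction w)
  case (Cons b w)
  have "r (Suc (length (w @ q))) \<le> r (length (w @ q))"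
    using length_seq_half[OF assms, of "length (w @ q)"] length_seq_pos[OF assms, of "length (w @ q)"]
    by linarith
  with Cons show ?case by simp
qed simp

lemma cantor_interval_nested:
  assumes "cantor_length_seq r"
  shows "cantor_interval a r (w @ q) \<subseteq> cantor_interval a r q"
proof -
  have "cantor_left a r (w @ q) + r (length (w @ q)) \<le> cantor_left a r q + r (length q)"
  proof (induction w)
    case (Cons b w)
    have "r (Suc (length (w @ q))) \<le> r (length (w @ q))"
      using length_seq_half[OF assms, of "length (w @ q)"]
        length_seq_pos[OF assms, of "length (w @ q)"] by linarith
    with Cons show ?case by simp
  qed simp
  with cantor_left_mono[OF assms, of a q w] show ?thesis
    by (auto simp: cantor_interval_def)
qed

text \<open>
  Intervals of one level have disjoint interiors, since a child is at most half as long as its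
  parent. Endpoints rather than intervals are compared because adjacent intervals may touch.
\<close>
lemma cantor_left_separated:
  assumes "cantor_length_seq r" "length q = length q'" "q \<noteq> q'"
  shows "r (length q) \<le> \<bar>cantor_left a r q - cantor_left a r q'\<bar>"
  using assms(2,3)
proof (induction q q' rule: list_induct2)
  case (Cons b q b' q')
  have half: "r (Suc (length q)) \<le> r (length q) / 2" and pos: "0 < r (length q)"
    by (rule length_seq_half[OF assms(1)] length_seq_pos[OF assms(1)])+
  show ?case
  proof (cases "q = q'")
    case True
    with Cons half pos show ?thesis by (auto simp: abs_if)
  next
    case False
    then have "r (length q) \<le> \<bar>cantor_left a r q - cantor_left a r q'\<bar>"
      using Cons by simp
    with half pos Cons.hyps show ?thesis by (auto simp: abs_if split: if_splits)
  qed
qed simp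

text \<open>Words grow at the head, so the ancestors of \<open>q\<close> are the lists \<open>drop i q\<close>.\<close>
lemma cantor_interval_drop:
  assumes "cantor_length_seq r"
  shows "cantor_interval a r q \<subseteq> cantor_interval a r (drop i q)"
  using cantor_interval_nested[OF assms, of a "take i q" "drop i q"] by simp

lemma cantor_left_in_prefix_interval:
  assumes "cantor_length_seq r"
  shows "cantor_left a r q \<in> cantor_interval a r (drop i q)"
proof (rule subsetD[OF cantor_interval_drop[OF assms]])
  show "cantor_left a r q \<in> cantor_interval a r q"
    using length_seq_pos[OF assms, of "length q"] by (simp add: cantor_interval_def)
qed

text \<open>
  Always passing to the left child keeps the left endpoint. These points serve as one test point
  for each interval of a given level.
\<close>
lemma cantor_left_in_cantor_set:
  assumes "cantor_length_seq r"
  shows "cantor_left a r q \<in> cantor_set a r"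
  unfolding cantor_set_def
proof (intro INT_I)
  fix n
  have pad: "cantor_left a r (replicate k False @ q) = cantor_left a r q" for k
    by (induction k) auto
  show "cantor_left a r q \<in> (\<Union>p\<in>{p. length p = n}. cantor_interval a r p)"
  proof (cases "n \<le> length q")
    case True
    then show ?thesis
      using cantor_left_in_prefix_interval[OF assms, of a q "length q - n"]
      by (intro UN_I[of "drop (length q - n) q"]) auto
  next
    case False
    let ?p = "replicate (n - length q) False @ q"
    from False cantor_left_in_prefix_interval[OF assms, of a ?p 0] show ?thesis
      by (intro UN_I[of ?p]) (simp_all add: pad)
  qed
qed

section \<open>Covers by short intervals\<close>

lemma microscopic_iff:
  "E \<in> small_cover_sets geom_seqs \<longleftrightarrow>
     (\<forall>k\<ge>1. \<exists>C. E \<subseteq> (\<Union>m\<in>{1..}. C m) \<and>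
       (\<forall>m\<ge>1. bounded (C m) \<and> diameter (C m) < 1 / 2 ^ (k * m)))"
proof -
  have eq: "geom_seqs = (\<lambda>k n. 1 / 2 ^ (k * n)) ` {1..}"
    by (auto simp: geom_seqs_def)
  show ?thesis
    unfolding small_cover_sets_def eq mem_Collect_eq ball_simps(9) by (auto simp: Ball_def)
qed

lemma card_words: "card {q :: bool list. length q = n} = 2 ^ n"
  using card_lists_length_eq[of "UNIV :: bool set" n] by simp

lemma finite_words: "finite {q :: bool list. length q = n}"
  using finite_lists_length_eq[of "UNIV :: bool set" n] by simp

lemma compact_cantor_set: "compact (cantor_set a r)"
proof -
  have cl: "closed (\<Union>q\<in>{q. length q = n}. cantor_interval a r q)" for n
    by (intro closed_UN finite_words) (auto simp: cantor_interval_def)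
  have "closed (cantor_set a r)"
    unfolding cantor_set_def by (intro closed_INT ballI cl)
  moreover have "bounded (cantor_set a r)"
  proof (rule bounded_subset)
    show "cantor_set a r \<subseteq> (\<Union>q\<in>{q. length q = 0}. cantor_interval a r q)"
      unfolding cantor_set_def by blast
  qed (simp add: cantor_interval_def)
  ultimately show ?thesis by (simp add: compact_eq_bounded_closed)
qed

lemma diameter_cantor_interval:
  assumes "cantor_length_seq r"
  shows "diameter (cantor_interval a r q) = r (length q)"
  using length_seq_pos[OF assms, of "length q"]
  by (simp add: cantor_interval_def)

lemma bounded_cantor_interval: "bounded (cantor_interval a r q)"
  by (simp add: cantor_interval_def)

text \<open>Numbers below \<open>2 ^ n\<close> enumerate the words of length \<open>n\<close> through their binary digits.\<close>
definition word_of_nat :: "nat \<Rightarrow> nat \<Rightarrow> bool list" where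
  "word_of_nat n m = map (bit m) [0..<n]"

lemma length_word_of_nat [simp]: "length (word_of_nat n m) = n"
  by (simp add: word_of_nat_def)

lemma word_of_nat_surj:
  obtains m where "m < 2 ^ length q" "word_of_nat (length q) m = q"
proof
  let ?m = "horner_sum of_bool 2 q :: nat"
  show "?m < 2 ^ length q" by (rule horner_sum_of_bool_2_less)
  show "word_of_nat (length q) ?m = q"
    by (rule nth_equalityI) (simp_all add: word_of_nat_def bit_horner_sum_bit_iff)
qed

lemma cantor_M_two_pow_subset:
  "cantor_M (\<lambda>n. 2 ^ n) \<subseteq> small_cover_sets geom_seqs \<inter> sym_cantor_sets"
proof
  fix E assume "E \<in> cantor_M (\<lambda>n. 2 ^ n)"
  then obtain a r where E: "E = cantor_set a r" and r: "cantor_length_seq r"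
    and inf: "\<And>e. e > 0 \<Longrightarrow> infinite {n. r n < e powr 2 ^ n}"
    unfolding cantor_M_def by blast
  have "\<exists>C. E \<subseteq> (\<Union>m\<in>{1..}. C m) \<and>
      (\<forall>m\<ge>1. bounded (C m) \<and> diameter (C m) < 1 / 2 ^ (k * m))" for k :: nat
  proof -
    obtain n where n: "r n < (1 / 2 ^ k) powr 2 ^ n"
      using inf[of "1 / 2 ^ k"] by (auto dest: infinite_imp_nonempty)
    have "(1 / 2 ^ k :: real) powr 2 ^ n = 1 / 2 ^ (k * 2 ^ n)"
      using powr_realpow[of "1 / 2 ^ k" "2 ^ n"] by (simp add: power_mult power_one_over)
    with n have small: "r n < 1 / 2 ^ (k * 2 ^ n)" by simp
    \<comment> \<open>The indices start at 1, the enumeration of words at 0.\<close>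
    define C where "C m = (if m \<le> 2 ^ n then cantor_interval a r (word_of_nat n (m - 1)) else {})"
      for m
    have "diameter (C m) < 1 / 2 ^ (k * m)" for m
    proof (cases "m \<le> 2 ^ n")
      case True
      then have "(1 / 2 ^ (k * 2 ^ n) :: real) \<le> 1 / 2 ^ (k * m)"
        by (simp add: field_simps)
      with True small show ?thesis by (simp add: C_def diameter_cantor_interval[OF r])
    qed (simp add: C_def)
    moreover have "bounded (C m)" for m by (simp add: C_def bounded_cantor_interval)
    moreover have "E \<subseteq> (\<Union>m\<in>{1..}. C m)"
    proof
      fix x assume "x \<in> E"
      then obtain q where q: "length q = n" "x \<in> cantor_interval a r q"
        unfolding E cantor_set_def by blast
      obtain m where "m < 2 ^ n" "word_of_nat n m = q"
        using word_of_nat_surj[of q] q by blast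
      with q have "x \<in> C (Suc m)" by (simp add: C_def)
      then show "x \<in> (\<Union>m\<in>{1..}. C m)" by auto
    qed
    ultimately show ?thesis by blast
  qed
  then have "E \<in> small_cover_sets geom_seqs" by (simp only: microscopic_iff) simp
  moreover have "E \<in> sym_cantor_sets" using r E unfolding sym_cantor_sets_def by blast
  ultimately show "E \<in> small_cover_sets geom_seqs \<inter> sym_cantor_sets" by blast
qed

section \<open>A microscopic set outside the smallest class\<close>

text \<open>
  Pigeonhole: the \<open>2 ^ Suc n\<close> left endpoints of level \<open>Suc n\<close> of the smaller set lie in the
  \<open>2 ^ n\<close> intervals of level \<open>n\<close> of the larger one, so two of them, which are at distance at least
  \<open>r (Suc n)\<close>, share an interval. For equal sets the bound compares any two representations.
\<close>
lemma length_le_of_cantor_set_subset: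
  assumes r: "cantor_length_seq r"
    and sub: "cantor_set a r \<subseteq> cantor_set a' r'"
  shows "r (Suc n) \<le> r' n"
proof (rule ccontr)
  assume "\<not> ?thesis"
  then have less: "r' n < r (Suc n)" by simp
  have "\<exists>w. length w = n \<and> cantor_left a r q \<in> cantor_interval a' r' w" for q
  proof -
    have "cantor_left a r q \<in> cantor_set a' r'"
      using sub cantor_left_in_cantor_set[OF r] by (rule subsetD)
    then show ?thesis by (auto simp: cantor_set_def)
  qed
  then obtain w where w: "\<And>q. length (w q) = n"
    "\<And>q. cantor_left a r q \<in> cantor_interval a' r' (w q)" by metis
  have "inj_on w {q. length q = Suc n}"
  proof (rule inj_onI, rule ccontr)
    fix p q assume *: "p \<in> {q. length q = Suc n}" "q \<in> {q. length q = Suc n}" "w p = w q" "p \<noteq> q"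
    then have "r (Suc n) \<le> \<bar>cantor_left a r p - cantor_left a r q\<bar>"
      using cantor_left_separated[OF r, of p q a] by simp
    moreover have "\<bar>cantor_left a r p - cantor_left a r q\<bar> \<le> r' n"
      using w[of p] w[of q] *(3) by (auto simp: cantor_interval_def abs_le_iff)
    ultimately show False using less by linarith
  qed
  then have "card {q :: bool list. length q = Suc n} \<le> card {q :: bool list. length q = n}"
    by (rule card_inj_on_le) (use w finite_words in auto)
  then show False by (simp add: card_words)
qed

text \<open>
  The witness has \<open>r n = (1 / 2) ^ 2 ^ n\<close>. To cover it, let \<open>2 * k \<le> 2 ^ t\<close> and split the set
  into its \<open>2 ^ t\<close> pieces of level \<open>t\<close>. The piece with number \<open>j\<close> contains \<open>2 ^ j\<close> intervals of
  level \<open>j + t\<close>, exactly as many as there are indices \<open>m\<close> with \<open>floor_log m = j\<close>; for these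
  \<open>k * m < 2 ^ (j + t)\<close>, so the intervals are short enough. Since \<open>r (Suc n) = (1 / 4) ^ 2 ^ n\<close>,
  the choice \<open>\<epsilon> = 1 / 4\<close> excludes every representation of the set in \<open>cantor_M (\<lambda>n. 2 ^ n)\<close>.
\<close>
lemma microscopic_not_in_cantor_M:
  "\<exists>E \<in> small_cover_sets geom_seqs \<inter> sym_cantor_sets. E \<notin> cantor_M (\<lambda>n. 2 ^ n)"
proof -
  define r :: "nat \<Rightarrow> real" where "r n = (1 / 2) ^ (2 ^ n)" for n
  have rS: "r (Suc n) = r n * r n" for n
    by (simp add: r_def mult_2 power_add)
  have pos: "0 < r n" for n by (simp add: r_def)
  have le: "r n \<le> 1 / 2" for n
    using power_decreasing[of 1 "2 ^ n" "1 / 2 :: real"] by (simp add: r_def)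
  have half: "r (Suc n) \<le> r n / 2" for n
    using mult_left_mono[OF le[of n], of "r n"] pos[of n] by (simp add: rS)
  have lim: "r \<longlonglongrightarrow> 0" unfolding r_def by real_asymp
  have r: "cantor_length_seq r"
    unfolding cantor_length_seq_def
  proof (intro conjI allI pos half lim)
    show "r (Suc n) < r n" for n using half[of n] pos[of n] by linarith
  qed
  have "\<exists>C. cantor_set 0 r \<subseteq> (\<Union>m\<in>{1..}. C m) \<and>
      (\<forall>m\<ge>1. bounded (C m) \<and> diameter (C m) < 1 / 2 ^ (k * m))" for k :: nat
  proof -
    define t where "t = Suc k"
    have kt: "2 * k \<le> 2 ^ t" unfolding t_def using less_exp[of k] by (simp add: less_imp_le)
    \<comment> \<open>With \<open>m = 2 ^ j + i\<close>, the tail selects the piece \<open>j\<close> and the front the interval \<open>i\<close> in it.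
      The numbers \<open>j \<ge> 2 ^ t\<close> only repeat pieces.\<close>
    define W where "W m = word_of_nat (floor_log m) (m - 2 ^ floor_log m) @ word_of_nat t (floor_log m)"
      for m
    define C where "C m = cantor_interval 0 r (W m)" for m
    have "diameter (C m) < 1 / 2 ^ (k * m)" if "m \<ge> 1" for m
    proof -
      have "m < 2 * 2 ^ floor_log m" using floor_log_exp2_gt[of m] by simp
      have "k * m < 2 ^ (floor_log m + t)"
      proof (cases "k = 0")
        case False
        then have "k * m < k * (2 * 2 ^ floor_log m)" using \<open>m < _\<close> by simp
        also have "\<dots> \<le> 2 ^ t * 2 ^ floor_log m"
          using mult_right_mono[OF kt, of "2 ^ floor_log m"] by (simp only: mult_ac le0)
        finally show ?thesis by (simp add: power_add mult_ac)
      qed simp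
      then have "(1 / 2 :: real) ^ (2 ^ (floor_log m + t)) < (1 / 2) ^ (k * m)"
        by (intro power_strict_decreasing) auto
      then show ?thesis
        by (simp add: C_def W_def diameter_cantor_interval[OF r] r_def power_one_over)
    qed
    moreover have "bounded (C m)" for m by (simp add: C_def bounded_cantor_interval)
    moreover have "cantor_set 0 r \<subseteq> (\<Union>m\<in>{1..}. C m)"
    proof
      fix x assume "x \<in> cantor_set 0 r"
      \<comment> \<open>A level beyond all levels \<open>j + t\<close> with \<open>j < 2 ^ t\<close>, so that the interval of each of
        these levels around \<open>x\<close> is an ancestor of one and the same interval.\<close>
      then obtain q where q: "length q = 2 ^ t + t" "x \<in> cantor_interval 0 r q"
        unfolding cantor_set_def by blast
      define u where "u = drop (2 ^ t) q"
      have u: "length u = t" by (simp add: u_def q)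
      obtain j where j: "j < 2 ^ t" "word_of_nat t j = u"
        using word_of_nat_surj[of u] u by auto
      define v where "v = take j (drop (2 ^ t - j) q)"
      have v: "length v = j" using j q by (simp add: v_def)
      obtain i where i: "i < 2 ^ j" "word_of_nat j i = v"
        using word_of_nat_surj[of v] v by auto
      have "v @ u = drop (2 ^ t - j) q"
        using append_take_drop_id[of j "drop (2 ^ t - j) q"] j(1) by (simp add: u_def v_def)
      moreover have "x \<in> cantor_interval 0 r (drop (2 ^ t - j) q)"
        using q(2) cantor_interval_drop[OF r] by (rule subsetD[rotated])
      ultimately have "x \<in> cantor_interval 0 r (v @ u)" by simp
      moreover have "floor_log (2 ^ j + i) = j"
        using i by (intro floor_log_eqI) auto
      ultimately have "x \<in> C (2 ^ j + i)" using i j by (simp add: C_def W_def)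
      moreover have "2 ^ j + i \<ge> 1" by (simp add: Suc_le_eq)
      ultimately show "x \<in> (\<Union>m\<in>{1..}. C m)" by blast
    qed
    ultimately show ?thesis by blast
  qed
  then have "cantor_set 0 r \<in> small_cover_sets geom_seqs" by (simp only: microscopic_iff) simp
  moreover have "cantor_set 0 r \<in> sym_cantor_sets" using r unfolding sym_cantor_sets_def by blast
  moreover have "cantor_set 0 r \<notin> cantor_M (\<lambda>n. 2 ^ n)"
  proof
    assume "cantor_set 0 r \<in> cantor_M (\<lambda>n. 2 ^ n)"
    then obtain a' r' where eq: "cantor_set 0 r = cantor_set a' r'"
      and "\<forall>e>0. infinite {n. r' n < e powr 2 ^ n}"
      unfolding cantor_M_def by blast
    then have "infinite {n. r' n < (1 / 4) powr 2 ^ n}" by simp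
    then obtain n where n: "r' n < (1 / 4) powr 2 ^ n" by (auto dest: infinite_imp_nonempty)
    have "(1 / 4 :: real) powr 2 ^ n = (1 / 4) ^ 2 ^ n"
      using powr_realpow[of "1 / 4" "2 ^ n"] by simp
    also have "\<dots> = r (Suc n)" by (simp add: r_def power_mult power2_eq_square)
    finally show False
      using n length_le_of_cantor_set_subset[OF r equalityD1[OF eq], of n] by simp
  qed
  ultimately show ?thesis by blast
qed

section \<open>A summability criterion against being microscopic\<close>

text \<open>
  A set of diameter below \<open>r n\<close> meets at most two intervals of level \<open>n\<close>: the left endpoints of
  the intervals that it meets differ by less than \<open>2 * r n\<close>, and among three numbers with gaps at
  least \<open>r n\<close> the extreme ones differ by at least \<open>2 * r n\<close>. Each of the two intervals has
  \<open>2 ^ (N - n)\<close> descendants of level \<open>N\<close>.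
\<close>
lemma card_words_in_small_set:
  assumes r: "cantor_length_seq r" and n: "n \<le> N"
    and U: "\<And>x y. x \<in> U \<Longrightarrow> y \<in> U \<Longrightarrow> dist x y < r n"
  shows "card {q. length q = N \<and> cantor_left a r q \<in> U} \<le> 2 * 2 ^ (N - n)"
proof -
  let ?Q = "{q. length q = N \<and> cantor_left a r q \<in> U}"
  \<comment> \<open>The ancestors of level \<open>n\<close>.\<close>
  define P where "P = drop (N - n) ` ?Q"
  have lenP: "length p = n" if "p \<in> P" for p using that n by (auto simp: P_def)
  have finP: "finite P" by (rule finite_subset[OF _ finite_words[of n]]) (use lenP in auto)
  have near: "\<bar>cantor_left a r p - cantor_left a r p'\<bar> < 2 * r n" if pp: "p \<in> P" "p' \<in> P" for p p'
  proof -
    obtain q q' where q: "q \<in> ?Q" "p = drop (N - n) q" "q' \<in> ?Q" "p' = drop (N - n) q'"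
      using pp[unfolded P_def] by (elim imageE) (rule that)
    have "cantor_left a r q \<in> cantor_interval a r p" "cantor_left a r q' \<in> cantor_interval a r p'"
      unfolding q(2,4) by (rule cantor_left_in_prefix_interval[OF r])+
    moreover have "\<bar>cantor_left a r q - cantor_left a r q'\<bar> < r n"
      using U[of "cantor_left a r q" "cantor_left a r q'"] q by (simp add: dist_real_def)
    ultimately show ?thesis
      using lenP pp by (auto simp: cantor_interval_def)
  qed
  have sep: "r n \<le> \<bar>cantor_left a r p - cantor_left a r p'\<bar>" if "p \<in> P" "p' \<in> P" "p \<noteq> p'" for p p'
    using cantor_left_separated[OF r, of p p' a] lenP that by simp
  have "card P \<le> 2"
  proof (rule ccontr)
    assume "\<not> card P \<le> 2"
    then obtain T where "T \<subseteq> P" "card T = 3"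
      using obtain_subset_with_card_n[of 3 P] by auto
    then obtain x y z where T: "x \<in> P" "y \<in> P" "z \<in> P" "x \<noteq> y" "y \<noteq> z" "x \<noteq> z"
      by (auto simp: card_3_iff)
    show False
      using near[OF T(1,2)] near[OF T(2,3)] near[OF T(1,3)]
        sep[OF T(1,2,4)] sep[OF T(2,3,5)] sep[OF T(1,3,6)] by linarith
  qed
  have "?Q \<subseteq> (\<lambda>(w, p). w @ p) ` ({w. length w = N - n} \<times> P)"
  proof
    fix q assume q: "q \<in> ?Q"
    have "q = (\<lambda>(w, p). w @ p) (take (N - n) q, drop (N - n) q)" by simp
    moreover have "(take (N - n) q, drop (N - n) q) \<in> {w. length w = N - n} \<times> P"
      using q by (auto simp: P_def)
    ultimately show "q \<in> (\<lambda>(w, p). w @ p) ` ({w. length w = N - n} \<times> P)" by (rule image_eqI)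
  qed
  then have "card ?Q \<le> card ({w :: bool list. length w = N - n} \<times> P)"
    by (rule surj_card_le[rotated]) (simp add: finP finite_words)
  also have "\<dots> = card P * 2 ^ (N - n)" by (simp add: card_cartesian_product card_words)
  also have "\<dots> \<le> 2 * 2 ^ (N - n)" using \<open>card P \<le> 2\<close> by simp
  finally show ?thesis .
qed

text \<open>The strict bound leaves room to make the covering sets open, as compactness requires.\<close>
lemma open_enlargement:
  fixes S :: "'a::metric_space set"
  assumes "bounded S" "diameter S < d"
  obtains U where "open U" "S \<subseteq> U" "\<And>x y. x \<in> U \<Longrightarrow> y \<in> U \<Longrightarrow> dist x y < d"
proof
  define e where "e = (d - diameter S) / 2"
  have e: "e > 0" using assms by (simp add: e_def)
  let ?U = "\<Union>x\<in>S. ball x e"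
  show "open ?U" by (intro open_UN ballI open_ball)
  show "S \<subseteq> ?U" using e by auto
  fix x y assume "x \<in> ?U" "y \<in> ?U"
  then obtain x' y' where *: "x' \<in> S" "y' \<in> S" "dist x' x < e" "dist y' y < e" by auto
  have "dist x' y' \<le> diameter S"
    using diameter_bounded_bound[OF assms(1) *(1,2)] .
  then have "dist x y < diameter S + 2 * e"
    using * dist_triangle[of x y x'] dist_triangle[of x' y y'] by (simp add: dist_commute)
  also have "diameter S + 2 * e = d" by (simp add: e_def field_simps)
  finally show "dist x y < d" .
qed

text \<open>
  This is subadditivity of the uniform probability measure on the Cantor set. The measure appears
  as the proportion of words of length \<open>N\<close>, for one \<open>N\<close> beyond all the levels \<open>\<nu> m\<close>.
\<close>
lemma finite_cover_weight:
  assumes r: "cantor_length_seq r" and F: "finite F"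
    and cover: "cantor_set a r \<subseteq> (\<Union>m\<in>F. U m)"
    and U: "\<And>m x y. m \<in> F \<Longrightarrow> x \<in> U m \<Longrightarrow> y \<in> U m \<Longrightarrow> dist x y < r (\<nu> m)"
  shows "1 \<le> (\<Sum>m\<in>F. 2 / 2 ^ \<nu> m :: real)"
proof -
  obtain N where N: "\<And>m. m \<in> F \<Longrightarrow> \<nu> m \<le> N"
    using finite_nat_set_iff_bounded_le[of "\<nu> ` F"] F by auto
  let ?Q = "\<lambda>m. {q. length q = N \<and> cantor_left a r q \<in> U m}"
  have "{q. length q = N} \<subseteq> (\<Union>m\<in>F. ?Q m)"
    using subsetD[OF cover cantor_left_in_cantor_set[OF r]] by auto
  then have "card {q :: bool list. length q = N} \<le> card (\<Union>m\<in>F. ?Q m)"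
    by (intro card_mono finite_UN_I F) (auto intro: finite_subset[OF _ finite_words[of N]])
  also have "\<dots> \<le> (\<Sum>m\<in>F. card (?Q m))" by (rule card_UN_le[OF F])
  also have "\<dots> \<le> (\<Sum>m\<in>F. 2 * 2 ^ (N - \<nu> m))"
    by (intro sum_mono card_words_in_small_set[OF r N U])
  finally have "(2 :: nat) ^ N \<le> (\<Sum>m\<in>F. 2 * 2 ^ (N - \<nu> m))" by (simp only: card_words)
  then have "real (2 ^ N) \<le> real (\<Sum>m\<in>F. 2 * 2 ^ (N - \<nu> m))" by (simp only: of_nat_le_iff)
  also have "\<dots> = (\<Sum>m\<in>F. 2 ^ N * (2 / 2 ^ \<nu> m))"
  proof -
    have "real (2 * 2 ^ (N - \<nu> m)) = 2 ^ N * (2 / 2 ^ \<nu> m)" if "m \<in> F" for m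
      using N[OF that] by (simp add: field_simps flip: power_add)
    then show ?thesis unfolding of_nat_sum by (intro sum.cong refl)
  qed
  also have "\<dots> = 2 ^ N * (\<Sum>m\<in>F. 2 / 2 ^ \<nu> m)" by (simp add: sum_distrib_left)
  finally show ?thesis by simp
qed

text \<open>
  Let \<open>\<nu> m\<close> be the level with \<open>r (Suc (\<nu> m)) < 1 / 2 ^ (k * m) \<le> r (\<nu> m)\<close>. The first inequality
  leaves at most \<open>\<bar>ln (r (Suc n))\<bar> / (k ln 2)\<close> indices \<open>m\<close> with \<open>\<nu> m = n\<close>, the second bounds the
  weight of each by \<open>2 / 2 ^ n\<close>. Grouping the cover by levels bounds its weight by \<open>8 S / k\<close>,
  where \<open>S\<close> is the sum of the series, and this is less than 1 for large \<open>k\<close>.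
\<close>
lemma not_microscopic_if_summable:
  assumes r: "cantor_length_seq r" and summ: "summable (\<lambda>n. \<bar>ln (r n)\<bar> / 2 ^ n)"
  shows "cantor_set a r \<notin> small_cover_sets geom_seqs"
proof
  assume "cantor_set a r \<in> small_cover_sets geom_seqs"
  then have cov: "\<exists>C. cantor_set a r \<subseteq> (\<Union>m\<in>{1..}. C m) \<and>
      (\<forall>m\<ge>1. bounded (C m) \<and> diameter (C m) < 1 / 2 ^ (k * m))" if "k \<ge> 1" for k
    using that unfolding microscopic_iff by blast
  define L where "L n = \<bar>ln (r n)\<bar>" for n
  define S where "S = (\<Sum>n. L n / 2 ^ n)"
  \<comment> \<open>The bound on \<open>r 0\<close> makes \<open>\<nu> m\<close> exist for every \<open>m \<ge> 1\<close>.\<close>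
  obtain k :: nat where k: "k \<ge> 1" "8 * S < k" "1 / 2 ^ k \<le> r 0"
  proof -
    obtain k1 :: nat where k1: "8 * S < k1" using reals_Archimedean2 by blast
    obtain k2 :: nat where k2: "(1 / 2) ^ k2 < r 0"
      using real_arch_pow_inv[of "r 0" "1 / 2"] length_seq_pos[OF r] by auto
    let ?k = "max 1 (max k1 k2)"
    have "(1 / 2 :: real) ^ ?k \<le> (1 / 2) ^ k2" by (rule power_decreasing) auto
    with k1 k2 show ?thesis by (intro that[of ?k]) (auto simp: power_one_over)
  qed
  obtain C where C: "cantor_set a r \<subseteq> (\<Union>m\<in>{1..}. C m)"
    "\<And>m. m \<ge> 1 \<Longrightarrow> bounded (C m)" "\<And>m. m \<ge> 1 \<Longrightarrow> diameter (C m) < 1 / 2 ^ (k * m)"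
    using cov[OF k(1)] by blast
  have "\<exists>U. open U \<and> C m \<subseteq> U \<and> (\<forall>x\<in>U. \<forall>y\<in>U. dist x y < 1 / 2 ^ (k * m))" if "m \<ge> 1" for m
    using open_enlargement[OF C(2,3)[OF that]] by metis
  then obtain U where U: "\<And>m. m \<ge> 1 \<Longrightarrow> open (U m)" "\<And>m. m \<ge> 1 \<Longrightarrow> C m \<subseteq> U m"
    "\<And>m x y. m \<ge> 1 \<Longrightarrow> x \<in> U m \<Longrightarrow> y \<in> U m \<Longrightarrow> dist x y < 1 / 2 ^ (k * m)"
    by metis
  obtain F where F: "F \<subseteq> {1..}" "finite F" "cantor_set a r \<subseteq> (\<Union>m\<in>F. U m)"
  proof (rule compactE_image[OF compact_cantor_set[of a r], of "{1..}" U])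
    show "cantor_set a r \<subseteq> (\<Union>m\<in>{1..}. U m)" using C(1) U(2) by fastforce
  qed (use U(1) in auto)
  have "\<exists>n. r (Suc n) < 1 / 2 ^ (k * m) \<and> 1 / 2 ^ (k * m) \<le> r n" if "m \<ge> 1" for m
  proof -
    let ?P = "\<lambda>n. r n < 1 / 2 ^ (k * m)"
    have "(1 / 2 :: real) ^ (k * m) \<le> (1 / 2) ^ k"
      using that by (intro power_decreasing) auto
    with k(3) have "\<not> ?P 0" by (simp add: power_one_over)
    moreover obtain j where "?P j"
    proof -
      have "r \<longlonglongrightarrow> 0" using r by (simp add: cantor_length_seq_def)
      then have "\<forall>\<^sub>F n in sequentially. ?P n" by (rule order_tendstoD) simp
      then show ?thesis using that by (auto simp: eventually_sequentially)
    qed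
    ultimately obtain n where "\<forall>i\<le>n. \<not> ?P i" "?P (Suc n)"
      using ex_least_nat_less[of ?P j] by blast
    then show ?thesis by (intro exI[of _ n]) (simp add: not_less)
  qed
  then obtain \<nu> where \<nu>: "\<And>m. m \<ge> 1 \<Longrightarrow> r (Suc (\<nu> m)) < 1 / 2 ^ (k * m)"
    "\<And>m. m \<ge> 1 \<Longrightarrow> 1 / 2 ^ (k * m) \<le> r (\<nu> m)" by metis
  have "1 \<le> (\<Sum>m\<in>F. 2 / 2 ^ \<nu> m :: real)"
  proof (rule finite_cover_weight[OF r F(2,3)])
    fix m x y assume "m \<in> F" "x \<in> U m" "y \<in> U m"
    then show "dist x y < r (\<nu> m)" using U(3)[of m x y] \<nu>(2)[of m] F(1) by fastforce
  qed
  also have "\<dots> = (\<Sum>n\<in>\<nu> ` F. \<Sum>m\<in>{m\<in>F. \<nu> m = n}. 2 / 2 ^ \<nu> m)"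
    by (rule sum.image_gen[OF F(2)])
  also have "\<dots> \<le> (\<Sum>n\<in>\<nu> ` F. 8 / k * (L (Suc n) / 2 ^ Suc n))"
  proof (rule sum_mono)
    fix n
    let ?M = "{m\<in>F. \<nu> m = n}"
    have "?M \<subseteq> {1..nat \<lfloor>2 * L (Suc n) / k\<rfloor>}"
    proof
      fix m assume "m \<in> ?M"
      then have m: "m \<ge> 1" "\<nu> m = n" using F(1) by auto
      have "ln (r (Suc n)) < ln (1 / 2 ^ (k * m))"
        using \<nu>(1)[OF m(1)] m(2) length_seq_pos[OF r] by simp
      also have "\<dots> = - (real (k * m) * ln 2)" by (simp add: ln_div ln_realpow)
      finally have "real (k * m) * ln 2 \<le> L (Suc n)" by (simp add: L_def)
      \<comment> \<open>Replacing \<open>ln 2\<close> by \<open>1 / 2\<close> turns the bound \<open>4 S / (k ln 2)\<close> into \<open>8 S / k\<close>.\<close>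
      moreover have "1 / 2 \<le> ln (2 :: real)" using ln2_ge_two_thirds by simp
      then have "real (k * m) * (1 / 2) \<le> real (k * m) * ln 2" by (rule mult_left_mono) simp
      ultimately have "real (k * m) \<le> 2 * L (Suc n)" by linarith
      then have "real m \<le> 2 * L (Suc n) / k" using k(1) by (simp add: field_simps)
      then show "m \<in> {1..nat \<lfloor>2 * L (Suc n) / k\<rfloor>}" using m by (simp add: le_nat_floor)
    qed
    then have "card ?M \<le> card {1..nat \<lfloor>2 * L (Suc n) / k\<rfloor>}" by (rule card_mono[rotated]) simp
    then have "card ?M \<le> nat \<lfloor>2 * L (Suc n) / k\<rfloor>" by simp
    then have "real (card ?M) \<le> real (nat \<lfloor>2 * L (Suc n) / k\<rfloor>)" by (simp only: of_nat_le_iff)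
    also have "\<dots> \<le> 2 * L (Suc n) / k" by (rule of_nat_floor) (simp add: L_def)
    finally have "real (card ?M) * (2 / 2 ^ n) \<le> 2 * L (Suc n) / k * (2 / 2 ^ n)"
      by (rule mult_right_mono) simp
    then show "(\<Sum>m\<in>?M. 2 / 2 ^ \<nu> m) \<le> 8 / k * (L (Suc n) / 2 ^ Suc n)" by simp
  qed
  also have "\<dots> = 8 / k * (\<Sum>n\<in>Suc ` \<nu> ` F. L n / 2 ^ n)"
    by (simp add: sum_distrib_left sum.reindex)
  also have "\<dots> \<le> 8 / k * S"
    unfolding S_def
    by (intro mult_left_mono sum_le_suminf) (use summ F in \<open>auto simp: L_def\<close>)
  also have "\<dots> < 1" using k by (simp add: field_simps)
  finally show False by simp
qed

section \<open>Comparison with the classes for bases below 2\<close>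

lemma microscopic_subset_cantor_M:
  assumes p: "1 < p" "p < 2"
  shows "small_cover_sets geom_seqs \<inter> sym_cantor_sets \<subseteq> cantor_M (\<lambda>n. p ^ n)"
proof
  fix E assume E: "E \<in> small_cover_sets geom_seqs \<inter> sym_cantor_sets"
  then obtain a r where Er: "E = cantor_set a r" and r: "cantor_length_seq r"
    unfolding sym_cantor_sets_def by blast
  have "infinite {n. r n < e powr p ^ n}" if e: "e > 0" for e
  proof
    assume "finite {n. r n < e powr p ^ n}"
    then have ev: "\<forall>\<^sub>F n in sequentially. e powr p ^ n \<le> r n"
      by (simp add: eventually_cofinite not_le flip: cofinite_eq_sequentially)
    have "r \<longlonglongrightarrow> 0" using r by (simp add: cantor_length_seq_def)
    then have "\<forall>\<^sub>F n in sequentially. r n < 1" by (rule order_tendstoD) simp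
    with ev have "\<forall>\<^sub>F n in sequentially. norm (\<bar>ln (r n)\<bar> / 2 ^ n) \<le> \<bar>ln e\<bar> * (p / 2) ^ n"
    proof eventually_elim
      case (elim n)
      have "ln (e powr p ^ n) \<le> ln (r n)"
        using elim(1) e by (intro ln_mono) auto
      then have "p ^ n * ln e \<le> ln (r n)" by simp
      moreover have "ln (r n) \<le> 0" using elim length_seq_pos[OF r, of n] by simp
      moreover have "- (p ^ n * ln e) \<le> \<bar>ln e\<bar> * p ^ n"
        using p abs_ge_minus_self[of "p ^ n * ln e"] by (simp add: abs_mult mult.commute)
      ultimately have "\<bar>ln (r n)\<bar> \<le> \<bar>ln e\<bar> * p ^ n" by linarith
      then show ?case by (simp add: power_divide divide_right_mono)
    qed
    moreover have "summable (\<lambda>n. \<bar>ln e\<bar> * (p / 2) ^ n)"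
      using p by (intro summable_mult summable_geometric) auto
    ultimately have "summable (\<lambda>n. \<bar>ln (r n)\<bar> / 2 ^ n)"
      by (rule summable_comparison_test_ev)
    with not_microscopic_if_summable[OF r] E Er show False by blast
  qed
  with r Er show "E \<in> cantor_M (\<lambda>n. p ^ n)" unfolding cantor_M_def by blast
qed

text \<open>
  The main term \<open>2 ^ n / (n + 3)\<^sup>2\<close> of \<open>- ln (r n)\<close> is summable after division by \<open>2 ^ n\<close> but
  outgrows \<open>p ^ n\<close> for each \<open>p < 2\<close>. The shift by 3 makes it monotone from \<open>n = 0\<close> on, and the
  summand \<open>n\<close> ensures that \<open>r\<close> at least halves in each step.
\<close>
lemma not_microscopic_in_cantor_M:
  "\<exists>E \<in> (\<Inter>p\<in>{1<..<2}. cantor_M (\<lambda>n. p ^ n)). E \<notin> small_cover_sets geom_seqs"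
proof -
  define h :: "nat \<Rightarrow> real" where "h n = 2 ^ n / (real n + 3)\<^sup>2" for n
  define r where "r n = exp (- (h n + real n))" for n
  have h0: "0 < h n" for n by (simp add: h_def)
  have hS: "h n \<le> h (Suc n)" for n
  proof -
    have "(real n + 4)\<^sup>2 \<le> 2 * (real n + 3)\<^sup>2"
      by (simp add: power2_eq_square algebra_simps)
    then have "2 * 2 ^ n / (2 * (real n + 3)\<^sup>2) \<le> 2 * 2 ^ n / (real n + 4)\<^sup>2"
      by (intro divide_left_mono) auto
    then show ?thesis by (simp add: h_def add.commute)
  qed
  have pos: "0 < r n" for n by (simp add: r_def)
  have half: "r (Suc n) \<le> r n / 2" for n
  proof -
    have "r (Suc n) \<le> exp (- (h n + real n) - 1)"
      using hS[of n] by (simp add: r_def)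
    also have "\<dots> = r n / exp 1" by (simp add: r_def exp_diff)
    also have "\<dots> \<le> r n / 2"
      using exp_ge_add_one_self[of 1] pos[of n] by (intro divide_left_mono) auto
    finally show ?thesis .
  qed
  have lim: "r \<longlonglongrightarrow> 0" unfolding r_def h_def by real_asymp
  have r: "cantor_length_seq r"
    unfolding cantor_length_seq_def
  proof (intro conjI allI pos half lim)
    show "r (Suc n) < r n" for n using half[of n] pos[of n] by linarith
  qed
  have "\<bar>ln (r n)\<bar> / 2 ^ n = inverse ((real (n + 3))\<^sup>2) + real n * (1 / 2) ^ n" for n
  proof -
    have "ln (r n) = - (h n + real n)" unfolding r_def by (rule ln_exp)
    then have "\<bar>ln (r n)\<bar> = h n + real n" using h0[of n] by linarith
    then show ?thesis
      by (simp add: h_def add_divide_distrib power_one_over inverse_eq_divide)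
  qed
  moreover have "summable (\<lambda>n. inverse ((real (n + 3))\<^sup>2))"
    using summable_ignore_initial_segment[OF inverse_power_summable[of 2, where ?'a = real], of 3]
    by simp
  moreover have "summable (\<lambda>n. real n * (1 / 2) ^ n)"
  proof (rule summable_comparison_test_ev)
    have "\<forall>\<^sub>F n in sequentially. real n * (1 / 2) ^ n \<le> (3 / 4) ^ n" by real_asymp
    then show "\<forall>\<^sub>F n in sequentially. norm (real n * (1 / 2) ^ n) \<le> (3 / 4) ^ n" by simp
  qed (simp add: summable_geometric)
  ultimately have "summable (\<lambda>n. \<bar>ln (r n)\<bar> / 2 ^ n)"
    by (simp add: summable_add)
  then have "cantor_set 0 r \<notin> small_cover_sets geom_seqs"
    by (rule not_microscopic_if_summable[OF r])
  moreover have "infinite {n. r n < e powr p ^ n}" if p: "1 < p" "p < 2" and e: "e > 0" for p e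
  proof -
    have "h n / p ^ n = (2 / p) ^ n / (real n + 3)\<^sup>2" for n
      by (simp add: h_def power_divide mult.commute)
    moreover have "filterlim (\<lambda>n. (2 / p) ^ n / (real n + 3)\<^sup>2) at_top sequentially"
    proof -
      define c where "c = ln (2 / p)"
      have c: "c > 0" "2 / p = exp c" using p by (simp_all add: c_def)
      from c(1) have "filterlim (\<lambda>n. exp c ^ n / (real n + 3)\<^sup>2) at_top sequentially"
        by real_asymp
      with c(2) show ?thesis by simp
    qed
    ultimately have "filterlim (\<lambda>n. h n / p ^ n) at_top sequentially" by simp
    then have "\<forall>\<^sub>F n in sequentially. - ln e < h n / p ^ n"
      by (simp add: filterlim_at_top_dense)
    then have "\<forall>\<^sub>F n in sequentially. r n < e powr p ^ n"
    proof eventually_elim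
      case (elim n)
      then have "- ln e * p ^ n < h n" using p by (simp add: field_simps)
      then show ?case using e by (simp add: r_def powr_def mult.commute)
    qed
    then show ?thesis
      using eventually_frequently[OF trivial_limit_sequentially]
      by (simp add: frequently_cofinite flip: cofinite_eq_sequentially)
  qed
  then have "cantor_set 0 r \<in> cantor_M (\<lambda>n. p ^ n)" if "1 < p" "p < 2" for p
    using r that unfolding cantor_M_def by blast
  then have "cantor_set 0 r \<in> (\<Inter>p\<in>{1<..<2}. cantor_M (\<lambda>n. p ^ n))" by simp
  ultimately show ?thesis by blast
qed

theorem proposition9p5:
  shows "cantor_M (\<lambda>n. 2 ^ n) \<subset> small_cover_sets geom_seqs \<inter> sym_cantor_sets
    \<and> small_cover_sets geom_seqs \<inter> sym_cantor_sets \<subset> (\<Inter>p\<in>{1<..<2}. cantor_M (\<lambda>n. p ^ n))"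
proof
  show "cantor_M (\<lambda>n. 2 ^ n) \<subset> small_cover_sets geom_seqs \<inter> sym_cantor_sets"
    using cantor_M_two_pow_subset microscopic_not_in_cantor_M by blast
  have "small_cover_sets geom_seqs \<inter> sym_cantor_sets \<subseteq> (\<Inter>p\<in>{1<..<2}. cantor_M (\<lambda>n. p ^ n))"
    using microscopic_subset_cantor_M by (intro INT_greatest) simp
  then show "small_cover_sets geom_seqs \<inter> sym_cantor_sets \<subset> (\<Inter>p\<in>{1<..<2}. cantor_M (\<lambda>n. p ^ n))"
    using not_microscopic_in_cantor_M by blast
qed

end
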